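(* Let $R$ be a ring. Then $R$ is uniquely $\pi$-clean if and only if both of the following hold: (1) For any $a\in R$, there exists an $m\in\mathbb{N}$ for which there is a unique idempotent $e\in R$ such that $a^m-e\in J^*(R)$. (2) $J^*(R)=\{x\in R\mid x^m-1\in U(R)\text{ for all } m\in\mathbb{N}\}$.
   Context: All rings are associative with identity, not necessarily commutative. $\mathbb{N}$ denotes the positive integers and $U(R)$ the group of units of $R$. $J^*(R)$ denotes the intersection of all maximal (two-sided) ideals of $R$. An element $x$ of a ring $R$ is uniquely clean if it can be written in exactly one way as $x=e+u$ with $e\in R$ an idempotent and $u\in R$ a unit. A ring $R$ is uniquely $\pi$-clean if for every $a\in R$ there exists $n\in\mathbb{N}$ such that $a^n$ is uniquely clean. *)

theory Defs
  imports "HOL-Algebra.Algebra"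
begin

definition idempotents :: "('a, 'b) ring_scheme \<Rightarrow> 'a set"
  where "idempotents R = {e \<in> carrier R. e \<otimes>\<^bsub>R\<^esub> e = e}"

(* Ideals in HOL-Algebra are two-sided and maximal ideals are proper.  The intersection is taken
   inside the carrier, so it is the whole ring if there are no maximal ideals (the zero ring). *)
definition Jstar :: "('a, 'b) ring_scheme \<Rightarrow> 'a set"
  where "Jstar R = {x \<in> carrier R. \<forall>M. maximalideal M R \<longrightarrow> x \<in> M}"

definition uniquely_clean :: "('a, 'b) ring_scheme \<Rightarrow> 'a \<Rightarrow> bool"
  where "uniquely_clean R x \<longleftrightarrow>
    (\<exists>!p. fst p \<in> idempotents R \<and> snd p \<in> Units R \<and> x = fst p \<oplus>\<^bsub>R\<^esub> snd p)"

definition uniquely_pi_clean_ring :: "('a, 'b) ring_scheme \<Rightarrow> bool"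
  where "uniquely_pi_clean_ring R \<longleftrightarrow>
    (\<forall>a \<in> carrier R. \<exists>n::nat. n > 0 \<and> uniquely_clean R (a [^]\<^bsub>R\<^esub> n))"

end

(*
  Idempotents are central in both directions: with z = er(1 - e), the decompositions
  e = (1 - e) + (2e - 1) = (1 - (e + z)) + (2e - 1 + z) must agree in a uniquely pi-clean ring,
  while condition (2) puts the square-zero element z into J*, so that (1) forces e = e + z.

  If all idempotents are central and a^n = e + u is clean, then R is an exchange ring: 1 - e lies in Ra
  and e in R(1 - a).  In such a ring an element w lies in J* as soon as Rw contains no nonzero
  idempotent.  If g in Rw were a nonzero idempotent for w = a^n - (1 - e), changing e to 1 - e and u
  to w on the corner gR would give a second clean decomposition of a^n; hence w lies in J*.
  The elements x of the set in (2) have some power x^n = 1 + (x^n - 1) uniquely clean, and the same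
  argument shows that Rx^n, hence Rx, contains no nonzero idempotent.

  Conversely, if a = e + w with w in J*, then a = (1 - e) + (2e - 1 + w) is clean, and any other
  decomposition f + v satisfies ef = (1 - e)(1 - f) = 0, since efv and (1 - e)(1 - f)v lie in J*,
  which contains no nonzero central idempotent.
*)

theory Submission
  imports Defs
begin

section \<open>Idempotents and Peirce corners in an arbitrary ring\<close>

context ring begin

text \<open>The library's rule set for \<open>algebra\<close> in noncommutative rings lacks \<open>r_one\<close>.\<close>
lemmas algebra_r_one [algebra ring "ring.zero R" "ring.add R" "a_inv R" "a_minus R" "monoid.one R" "monoid.mult R"] = r_one

lemma idempotents_iff: "e \<in> idempotents R \<longleftrightarrow> e \<in> carrier R \<and> e \<otimes> e = e"
  by (simp add: idempotents_def)

lemma one_minus_idempotent: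
  assumes "e \<in> idempotents R"
  shows "\<one> \<ominus> e \<in> idempotents R" "e \<otimes> (\<one> \<ominus> e) = \<zero>" "(\<one> \<ominus> e) \<otimes> e = \<zero>" "\<one> \<ominus> (\<one> \<ominus> e) = e"
proof -
  have e: "e \<in> carrier R" "e \<otimes> e = e" using assms by (auto simp: idempotents_iff)
  show z: "e \<otimes> (\<one> \<ominus> e) = \<zero>" "(\<one> \<ominus> e) \<otimes> e = \<zero>" using e 
    by (simp_all add: minus_eq r_distr l_distr r_minus l_minus r_neg)
  show "\<one> \<ominus> (\<one> \<ominus> e) = e" using e by algebra
  have "(\<one> \<ominus> e) \<otimes> (\<one> \<ominus> e) = (\<one> \<ominus> e) \<ominus> e \<otimes> (\<one> \<ominus> e)" using e by algebra
  also have "\<dots> = \<one> \<ominus> e" using z(1) e by algebra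
  finally show "\<one> \<ominus> e \<in> idempotents R" using e by (simp add: idempotents_iff)
qed

lemma idempotent_pow:
  assumes "e \<in> idempotents R" "n > 0"
  shows "e [^] (n::nat) = e"
  using assms(2)
proof (induction n)
  case (Suc n)
  then show ?case using assms(1) by (cases n) (auto simp: idempotents_iff)
qed simp

text \<open>The factor is the geometric sum of \<open>x [^] i\<close> over \<open>i < n\<close>. It
  turns left multiples of \<open>1 - a^n\<close> into left multiples of \<open>1 - a\<close> in
  \<open>clean_pow_exchange\<close>.\<close>

lemma one_minus_pow:
  assumes "x \<in> carrier R"
  shows "\<exists>s \<in> carrier R. \<one> \<ominus> x [^] (n::nat) = s \<otimes> (\<one> \<ominus> x)"
proof (induction n)
  case 0
  then show ?case using assms by (intro bexI[of _ "\<zero>"]) (auto simp: minus_eq r_neg)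
next
  case (Suc n)
  then obtain s where s: "s \<in> carrier R" "\<one> \<ominus> x [^] n = s \<otimes> (\<one> \<ominus> x)" by blast
  have "\<one> \<ominus> x [^] Suc n = (\<one> \<ominus> x [^] n) \<oplus> x [^] n \<otimes> (\<one> \<ominus> x)"
    using assms nat_pow_closed[OF assms, of n] unfolding nat_pow_Suc by algebra
  also have "\<dots> = (s \<oplus> x [^] n) \<otimes> (\<one> \<ominus> x)"
    using assms s nat_pow_closed[OF assms, of n] by algebra
  finally show ?case using assms s by (intro bexI[of _ "s \<oplus> x [^] n"]) auto
qed

text \<open>The hypothesis, applied to \<open>e\<close> and to \<open>1 - e\<close>, kills both
  off-diagonal Peirce components of \<open>r\<close>, so \<open>er\<close> and \<open>re\<close>
  both equal \<open>ere\<close>.\<close>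

lemma idempotents_central_if:
  assumes "\<And>e r. e \<in> idempotents R \<Longrightarrow> r \<in> carrier R \<Longrightarrow> e \<otimes> r \<otimes> (\<one> \<ominus> e) = \<zero>"
    and e: "e \<in> idempotents R" and r: "r \<in> carrier R"
  shows "e \<otimes> r = r \<otimes> e"
proof -
  have ec: "e \<in> carrier R" using e by (simp add: idempotents_iff)
  have 1: "e \<otimes> r \<otimes> (\<one> \<ominus> e) = \<zero>" using assms by blast
  have 2: "(\<one> \<ominus> e) \<otimes> r \<otimes> e = \<zero>"
    using assms(1)[OF one_minus_idempotent(1)[OF e] r] one_minus_idempotent(4)[OF e] by simp
  have "e \<otimes> r = e \<otimes> r \<otimes> (\<one> \<ominus> e) \<oplus> e \<otimes> r \<otimes> e" using ec r by algebra
  also have "\<dots> = (\<one> \<ominus> e) \<otimes> r \<otimes> e \<oplus> e \<otimes> r \<otimes> e" using 1 2 by simp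
  also have "\<dots> = r \<otimes> e" using ec r by algebra
  finally show ?thesis .
qed

text \<open>Elements of the corner \<open>eR(1 - e)\<close> are fixed by \<open>e\<close> on the
  left and killed by it on the right. Both directions of the theorem compare \<open>e\<close> with
  the perturbed idempotent \<open>e + z\<close> in order to force \<open>z = 0\<close>.\<close>

lemma peirce_corner:
  assumes e: "e \<in> idempotents R" and r: "r \<in> carrier R"
  defines "z \<equiv> e \<otimes> r \<otimes> (\<one> \<ominus> e)"
  shows "z \<in> carrier R" "e \<otimes> z = z" "z \<otimes> e = \<zero>" "z \<otimes> z = \<zero>" "e \<oplus> z \<in> idempotents R"
proof -
  have ec: "e \<in> carrier R" "e \<otimes> e = e" using e by (auto simp: idempotents_iff)
  show zc: "z \<in> carrier R" using ec r by (simp add: z_def)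
  show ez: "e \<otimes> z = z" using ec r by (simp add: z_def m_assoc[symmetric])
  show ze: "z \<otimes> e = \<zero>" using ec r by (simp add: z_def m_assoc one_minus_idempotent[OF e])
  have "z \<otimes> z = z \<otimes> (e \<otimes> z)" using ez by simp
  also have "\<dots> = \<zero>" using ec zc ze by (simp add: m_assoc[symmetric])
  finally show zz: "z \<otimes> z = \<zero>" .
  have "(e \<oplus> z) \<otimes> (e \<oplus> z) = e \<otimes> e \<oplus> e \<otimes> z \<oplus> z \<otimes> e \<oplus> z \<otimes> z" using ec(1) zc by algebra
  then show "e \<oplus> z \<in> idempotents R" using ec zc ez ze zz by (simp add: idempotents_iff)
qed

lemma UnitsI: "x \<in> carrier R \<Longrightarrow> y \<in> carrier R \<Longrightarrow> x \<otimes> y = \<one> \<Longrightarrow> y \<otimes> x = \<one> \<Longrightarrow> x \<in> Units R"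
  by (auto simp: Units_def)

lemma idempotent_reflection:
  assumes e: "e \<in> idempotents R"
  shows "(e \<ominus> (\<one> \<ominus> e)) \<otimes> (e \<ominus> (\<one> \<ominus> e)) = \<one>"
proof -
  have ec: "e \<in> carrier R" "e \<otimes> e = e" using e by (auto simp: idempotents_iff)
  \<comment> \<open>With \<open>q = 2e - 1\<close> this is \<open>q^2 = 1 + 4(e^2 - e)\<close>, the
    four copies of \<open>e^2 - e\<close> being written out.\<close>
  have "(e \<ominus> (\<one> \<ominus> e)) \<otimes> (e \<ominus> (\<one> \<ominus> e)) = \<one> \<oplus> (e \<otimes> e \<ominus> e) \<oplus> (e \<otimes> e \<ominus> e) \<oplus> (e \<otimes> e \<ominus> e) \<oplus> (e \<otimes> e \<ominus> e)"
    using ec(1) by algebra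
  also have "\<dots> = \<one>" using ec by (simp add: minus_eq r_neg)
  finally show ?thesis .
qed

lemma uniquely_clean_idempotents_central:
  assumes uc: "\<And>e. e \<in> idempotents R \<Longrightarrow> uniquely_clean R e"
    and e: "e \<in> idempotents R" and r: "r \<in> carrier R"
  shows "e \<otimes> r = r \<otimes> e"
proof (rule idempotents_central_if[OF _ e r])
  fix e r assume e: "e \<in> idempotents R" and r: "r \<in> carrier R"
  define z where "z = e \<otimes> r \<otimes> (\<one> \<ominus> e)"
  define q where "q = e \<ominus> (\<one> \<ominus> e)"
  note z = peirce_corner[OF e r, folded z_def]
  have ec: "e \<in> carrier R" using e by (simp add: idempotents_iff)
  have qc: "q \<in> carrier R" using ec by (simp add: q_def)
  have qq: "q \<otimes> q = \<one>" unfolding q_def by (rule idempotent_reflection[OF e])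
  have "q \<otimes> z = e \<otimes> z \<ominus> z \<oplus> e \<otimes> z" "z \<otimes> q = z \<otimes> e \<ominus> z \<oplus> z \<otimes> e"
    unfolding q_def using ec z(1) by algebra+
  then have qz: "q \<otimes> z = z" and zq: "z \<otimes> q = \<ominus> z"
    using z by (simp_all add: minus_eq r_neg)
  \<comment> \<open>As \<open>qz = z\<close> and \<open>zq = -z\<close>, the cross terms cancel, so
    \<open>q + z\<close> is its own inverse, just like \<open>q\<close>.\<close>
  have "(q \<oplus> z) \<otimes> (q \<oplus> z) = q \<otimes> q \<oplus> q \<otimes> z \<oplus> z \<otimes> q \<oplus> z \<otimes> z"
    using qc z(1) by algebra
  also have "\<dots> = \<one>" using z(1) by (simp add: qq qz zq z(4) a_assoc r_neg)
  finally have u: "q \<oplus> z \<in> Units R" "q \<in> Units R"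
    using qc z(1) qq by (auto intro: UnitsI)
  let ?p = "(\<one> \<ominus> e, q)" and ?p' = "(\<one> \<ominus> (e \<oplus> z), q \<oplus> z)"
  have "e = (\<one> \<ominus> e) \<oplus> q" "e = (\<one> \<ominus> (e \<oplus> z)) \<oplus> (q \<oplus> z)"
    unfolding q_def using ec z(1) by algebra+
  then have "?p = ?p'"
    using uc[OF e] u one_minus_idempotent(1)[OF e] one_minus_idempotent(1)[OF z(5)]
    unfolding uniquely_clean_def by (metis fst_conv snd_conv)
  then have "q = q \<oplus> z" by simp
  then show "e \<otimes> r \<otimes> (\<one> \<ominus> e) = \<zero>" using qc z(1) unfolding z_def[symmetric]
    by simp
qed

text \<open>For \<open>m = 1\<close> the inverse is \<open>-1 - z\<close>, a truncated geometric
  series; for larger \<open>m\<close> the power vanishes and the unit \<open>-1\<close> remains.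
  This puts square-zero elements into the set of condition (2).\<close>

lemma square_zero_imp_unit:
  assumes "z \<in> carrier R" "z \<otimes> z = \<zero>" "(m::nat) > 0"
  shows "z [^] m \<ominus> \<one> \<in> Units R"
proof -
  have m1: "\<ominus> \<one> \<in> Units R" by (rule UnitsI[of _ "\<ominus> \<one>"]) (auto simp: l_minus)
  consider "m = 1" | k where "m = Suc (Suc k)"
    using assms(3) by (cases m rule: nat.exhaust; cases "m - 1") auto
  then show ?thesis
  proof cases
    case 1
    have "(z \<ominus> \<one>) \<otimes> (\<ominus> \<one> \<ominus> z) = \<one> \<ominus> z \<otimes> z" "(\<ominus> \<one> \<ominus> z) \<otimes> (z \<ominus> \<one>) = \<one> \<ominus> z \<otimes> z"
      using assms(1) by algebra+
    then show ?thesis using 1 assms by (auto intro!: UnitsI[of _ "\<ominus> \<one> \<ominus> z"] simp: minus_eq)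
  next
    case 2
    then show ?thesis using assms m1 by (simp add: m_assoc minus_eq)
  qed
qed

section \<open>Maximal ideals, \<open>Jstar\<close> and the Jacobson radical\<close>

lemma maximalideal_exists:
  assumes I: "ideal I R" "I \<noteq> carrier R"
  shows "\<exists>M. maximalideal M R \<and> I \<subseteq> M"
proof -
  \<comment> \<open>Properness is expressed as \<open>\<one> \<notin> K\<close>, a form that
    survives unions of chains, as Zorn's lemma requires.\<close>
  define A where "A = {K. ideal K R \<and> I \<subseteq> K \<and> \<one> \<notin> K}"
  have IA: "I \<in> A" using I ideal.one_imp_carrier by (auto simp: A_def)
  have "\<exists>M\<in>A. \<forall>K\<in>A. M \<subseteq> K \<longrightarrow> K = M"
  proof (rule subset_Zorn_nonempty)
    show "A \<noteq> {}" using IA by blast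
    fix \<C> assume "\<C> \<noteq> {}" and "subset.chain A \<C>"
    moreover from this have "ideal (\<Union>\<C>) R"
      using chain_Union_is_ideal[of \<C>] by (auto simp: A_def subset_chain_def)
    ultimately show "\<Union>\<C> \<in> A" by (auto simp: A_def subset_chain_def)
  qed
  then obtain M where M: "M \<in> A" and mx: "\<And>K. K \<in> A \<Longrightarrow> M \<subseteq> K \<Longrightarrow> K = M" by blast
  have "maximalideal M R"
  proof (rule maximalidealI)
    show "ideal M R" "carrier R \<noteq> M" using M by (auto simp: A_def)
    fix K assume "ideal K R" "M \<subseteq> K" "K \<subseteq> carrier R"
    then show "K = M \<or> K = carrier R"
      using mx[of K] M ideal.one_imp_carrier[of K R] by (auto simp: A_def)
  qed
  then show ?thesis using M by (auto simp: A_def)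
qed

lemma Jstar_closed: "x \<in> Jstar R \<Longrightarrow> x \<in> carrier R"
  by (simp add: Jstar_def)

lemma Jstar_l_closed: "x \<in> Jstar R \<Longrightarrow> r \<in> carrier R \<Longrightarrow> r \<otimes> x \<in> Jstar R"
  by (auto simp: Jstar_def intro: ideal.I_l_closed maximalideal.axioms(1))

lemma Jstar_r_closed: "x \<in> Jstar R \<Longrightarrow> r \<in> carrier R \<Longrightarrow> x \<otimes> r \<in> Jstar R"
  by (auto simp: Jstar_def intro: ideal.I_r_closed maximalideal.axioms(1))

lemma Jstar_minus_closed:
  assumes "x \<in> Jstar R" "y \<in> Jstar R"
  shows "x \<ominus> y \<in> Jstar R"
proof -
  have "x \<ominus> y \<in> M" if "maximalideal M R" for M
  proof -
    interpret maximalideal M R by fact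
    show ?thesis using assms that by (simp add: Jstar_def minus_eq)
  qed
  then show ?thesis using assms by (auto simp: Jstar_def)
qed

lemma Jstar_uminus_closed:
  assumes "x \<in> Jstar R"
  shows "\<ominus> x \<in> Jstar R"
  using Jstar_l_closed[OF assms, of "\<ominus> \<one>"] assms by (simp add: Jstar_closed l_minus)

text \<open>Jacobson's lemma: if \<open>c\<close> inverts \<open>1 - ab\<close>, then
  \<open>1 + bca\<close> inverts \<open>1 - ba\<close>.\<close>

lemma one_minus_mult_Units_swap:
  assumes "a \<in> carrier R" "b \<in> carrier R" "\<one> \<ominus> a \<otimes> b \<in> Units R"
  shows "\<one> \<ominus> b \<otimes> a \<in> Units R"
proof -
  obtain c where c: "c \<in> carrier R" "c \<otimes> (\<one> \<ominus> a \<otimes> b) = \<one>" "(\<one> \<ominus> a \<otimes> b) \<otimes> c = \<one>"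
    using assms(3) by (auto simp: Units_def)
  have "(\<one> \<ominus> b \<otimes> a) \<otimes> (\<one> \<oplus> b \<otimes> c \<otimes> a) = \<one> \<ominus> b \<otimes> a \<oplus> b \<otimes> ((\<one> \<ominus> a \<otimes> b) \<otimes> c) \<otimes> a"
    using assms(1,2) c(1) by algebra
  also have "\<dots> = \<one>" unfolding c(3) using assms(1,2) by algebra
  finally have 1: "(\<one> \<ominus> b \<otimes> a) \<otimes> (\<one> \<oplus> b \<otimes> c \<otimes> a) = \<one>" .
  have "(\<one> \<oplus> b \<otimes> c \<otimes> a) \<otimes> (\<one> \<ominus> b \<otimes> a) = \<one> \<ominus> b \<otimes> a \<oplus> b \<otimes> (c \<otimes> (\<one> \<ominus> a \<otimes> b)) \<otimes> a"
    using assms(1,2) c(1) by algebra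
  also have "\<dots> = \<one>" unfolding c(2) using assms(1,2) by algebra
  finally show ?thesis using 1 assms(1,2) c(1) by (intro UnitsI) auto
qed

text \<open>The elementwise description of the Jacobson radical by quasi-regularity; it avoids
  maximal one-sided ideals.\<close>

definition jacobson_radical :: "'a set"
  where "jacobson_radical = {w \<in> carrier R. \<forall>y \<in> carrier R. \<one> \<ominus> y \<otimes> w \<in> Units R}"

text \<open>With \<open>u = 1 - yw\<close> a unit, \<open>1 - y(w + w')\<close> factors as
  \<open>u(1 - u^-1 y w')\<close>, a product of two units.\<close>

lemma jacobson_radical_add:
  assumes "w \<in> jacobson_radical" "w' \<in> jacobson_radical"
  shows "w \<oplus> w' \<in> jacobson_radical"
proof -
  have wc: "w \<in> carrier R" "w' \<in> carrier R" using assms by (auto simp: jacobson_radical_def)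
  have "\<one> \<ominus> y \<otimes> (w \<oplus> w') \<in> Units R" if y: "y \<in> carrier R" for y
  proof -
    define u where "u = \<one> \<ominus> y \<otimes> w"
    have u: "u \<in> Units R" using assms y by (simp add: u_def jacobson_radical_def)
    then have u': "u \<in> carrier R" "inv u \<in> carrier R" "u \<otimes> inv u = \<one>" by auto
    have "\<one> \<ominus> inv u \<otimes> y \<otimes> w' \<in> Units R"
      using assms(2) u' y by (simp add: jacobson_radical_def)
    then have "u \<otimes> (\<one> \<ominus> inv u \<otimes> y \<otimes> w') \<in> Units R" using u by blast
    also have "u \<otimes> (\<one> \<ominus> inv u \<otimes> y \<otimes> w') = u \<ominus> (u \<otimes> inv u) \<otimes> (y \<otimes> w')"
      using u'(1,2) y wc by algebra
    also have "\<dots> = \<one> \<ominus> y \<otimes> (w \<oplus> w')" unfolding u'(3) unfolding u_def using y wc by algebra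
    finally show ?thesis .
  qed
  then show ?thesis using wc by (auto simp: jacobson_radical_def)
qed

lemma jacobson_radical_l_closed:
  assumes "w \<in> jacobson_radical" "r \<in> carrier R"
  shows "r \<otimes> w \<in> jacobson_radical"
  using assms by (auto simp: jacobson_radical_def m_assoc[symmetric])

text \<open>Jacobson's lemma trades \<open>1 - (yw)r\<close> for \<open>1 - r(yw)\<close>, where
  \<open>ry\<close> is just another left multiplier of \<open>w\<close>.\<close>

lemma jacobson_radical_r_closed:
  assumes "w \<in> jacobson_radical" "r \<in> carrier R"
  shows "w \<otimes> r \<in> jacobson_radical"
proof -
  have wc: "w \<in> carrier R" using assms by (auto simp: jacobson_radical_def)
  have "\<one> \<ominus> y \<otimes> (w \<otimes> r) \<in> Units R" if y: "y \<in> carrier R" for y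
  proof -
    have "\<one> \<ominus> r \<otimes> (y \<otimes> w) \<in> Units R"
      using assms y wc by (auto simp: jacobson_radical_def m_assoc[symmetric])
    from one_minus_mult_Units_swap[OF _ _ this] show ?thesis
      using assms y wc by (simp add: m_assoc)
  qed
  then show ?thesis using assms wc by (auto simp: jacobson_radical_def)
qed

lemma ideal_jacobson_radical: "ideal jacobson_radical R"
proof (rule idealI[OF ring_axioms])
  show "subgroup jacobson_radical (add_monoid R)"
  proof (rule add.subgroupI)
    show "jacobson_radical \<subseteq> carrier R" by (auto simp: jacobson_radical_def)
    have "\<zero> \<in> jacobson_radical" by (auto simp: jacobson_radical_def minus_eq)
    then show "jacobson_radical \<noteq> {}" by blast
    fix w assume w: "w \<in> jacobson_radical"
    then have "w \<in> carrier R" by (auto simp: jacobson_radical_def)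
    then show "\<ominus> w \<in> jacobson_radical"
      using jacobson_radical_l_closed[OF w, of "\<ominus> \<one>"] by (simp add: l_minus)
  qed (rule jacobson_radical_add)
qed (rule jacobson_radical_l_closed jacobson_radical_r_closed; assumption)+

text \<open>If a maximal ideal \<open>M\<close> did not contain the radical, their sum would be the
  whole ring, so \<open>1 = m + j\<close>; then \<open>m = 1 - j\<close> would be a unit inside
  \<open>M\<close>. The inclusion yields a unit criterion for membership in
  \<open>Jstar\<close>.\<close>

lemma jacobson_radical_subset_Jstar: "jacobson_radical \<subseteq> Jstar R"
proof -
  have "jacobson_radical \<subseteq> M" if "maximalideal M R" for M
  proof -
    interpret maximalideal M R by fact
    have Mc: "M \<subseteq> carrier R" by (rule a_subset)
    have Jc: "jacobson_radical \<subseteq> carrier R" by (auto simp: jacobson_radical_def)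
    have 0: "\<zero> \<in> jacobson_radical" by (auto simp: jacobson_radical_def minus_eq)
    have id: "ideal (M <+> jacobson_radical) R"
      using add_ideals is_ideal ideal_jacobson_radical by blast
    have sub: "M \<subseteq> M <+> jacobson_radical"
    proof
      fix m assume "m \<in> M"
      then show "m \<in> M <+> jacobson_radical"
        using 0 Mc r_zero[of m] unfolding set_add_def' by force
    qed
    have "M <+> jacobson_radical \<subseteq> carrier R" using Mc Jc unfolding set_add_def' by blast
    from I_maximal[OF id sub this] show ?thesis
    proof
      assume eq: "M <+> jacobson_radical = M"
      show ?thesis
      proof
        fix j assume "j \<in> jacobson_radical"
        then have "\<zero> \<oplus> j \<in> M <+> jacobson_radical" "j \<in> carrier R"
          using Jc zero_closed unfolding set_add_def' by blast+
        then show "j \<in> M" by (simp add: eq)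
      qed
    next
      assume "M <+> jacobson_radical = carrier R"
      then have "\<one> \<in> M <+> jacobson_radical" by simp
      then obtain m j where mj: "m \<in> M" "j \<in> jacobson_radical" "\<one> = m \<oplus> j"
        unfolding set_add_def' by blast
      then have c: "m \<in> carrier R" "j \<in> carrier R" using Mc Jc by auto
      have "\<one> \<ominus> \<one> \<otimes> j \<in> Units R" using mj(2) unfolding jacobson_radical_def by blast
      moreover have "\<one> \<ominus> \<one> \<otimes> j = m" 
      proof -
        have "(m \<oplus> j) \<ominus> \<one> \<otimes> j = m" using c by algebra
        then show ?thesis by (simp flip: mj(3))
      qed
      ultimately have "m \<in> Units R" by simp
      then have "\<one> \<in> M" using mj(1) I_l_closed[OF mj(1), of "inv m"] by simp
      then show ?thesis using one_imp_carrier I_notcarr by simp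
    qed
  qed
  then show ?thesis by (auto simp: Jstar_def jacobson_radical_def)
qed

end

section \<open>Rings whose idempotents are all central; multiplication need not commute\<close>

locale abelian_ring = ring +
  assumes idempotent_central: "e \<in> idempotents R \<Longrightarrow> x \<in> carrier R \<Longrightarrow> e \<otimes> x = x \<otimes> e"
begin

text \<open>Direct finiteness: \<open>ab\<close> is idempotent, hence central, and moving it past
  \<open>a\<close> in \<open>(ba)(ab)\<close> gives \<open>(ba)(ba) = 1\<close>. From here on a left
  inverse suffices to recognise a unit.\<close>

lemma left_inverse_imp_Units:
  assumes ab: "a \<in> carrier R" "b \<in> carrier R" "b \<otimes> a = \<one>"
  shows "a \<in> Units R"
proof -
  have idem: "a \<otimes> b \<in> idempotents R"
    using ab by (simp add: idempotents_iff) (metis l_one m_assoc m_closed)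
  have "a \<otimes> b = (b \<otimes> a) \<otimes> (a \<otimes> b)" using ab by simp
  also have "\<dots> = b \<otimes> (a \<otimes> (a \<otimes> b))" using ab(1,2) by (simp add: m_assoc)
  also have "\<dots> = b \<otimes> ((a \<otimes> b) \<otimes> a)" using idempotent_central[OF idem ab(1)] by simp
  also have "\<dots> = (b \<otimes> a) \<otimes> (b \<otimes> a)" using ab(1,2) by (simp add: m_assoc)
  also have "\<dots> = \<one>" using ab by simp
  finally show ?thesis using ab by (intro UnitsI) auto
qed

lemma idempotent_mult:
  assumes "e \<in> idempotents R" "f \<in> idempotents R"
  shows "e \<otimes> f \<in> idempotents R"
proof -
  have c: "e \<in> carrier R" "f \<in> carrier R" "e \<otimes> e = e" "f \<otimes> f = f"
    using assms by (auto simp: idempotents_iff)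
  have "(e \<otimes> f) \<otimes> (e \<otimes> f) = e \<otimes> (f \<otimes> e) \<otimes> f" using c(1,2) by (simp add: m_assoc)
  also have "f \<otimes> e = e \<otimes> f" using assms c idempotent_central by simp
  also have "e \<otimes> (e \<otimes> f) \<otimes> f = (e \<otimes> e) \<otimes> (f \<otimes> f)" using c(1,2) by (simp add: m_assoc)
  finally show ?thesis using c by (simp add: idempotents_iff)
qed

lemma idempotent_mult_distrib:
  assumes "g \<in> idempotents R" "a \<in> carrier R" "b \<in> carrier R"
  shows "(g \<otimes> a) \<otimes> (g \<otimes> b) = g \<otimes> (a \<otimes> b)"
proof -
  have g: "g \<in> carrier R" "g \<otimes> g = g" using assms by (auto simp: idempotents_iff)
  have "(g \<otimes> a) \<otimes> (g \<otimes> b) = g \<otimes> (a \<otimes> g) \<otimes> b" using g(1) assms by (simp add: m_assoc)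
  also have "a \<otimes> g = g \<otimes> a" using assms idempotent_central by simp
  also have "g \<otimes> (g \<otimes> a) \<otimes> b = (g \<otimes> g) \<otimes> (a \<otimes> b)" using g(1) assms by (simp add: m_assoc)
  finally show ?thesis using g by simp
qed

lemma orthogonal_mult_zero:
  assumes "g \<in> idempotents R" "h \<in> idempotents R" "g \<otimes> h = \<zero>" "a \<in> carrier R" "b \<in> carrier R"
  shows "(g \<otimes> a) \<otimes> (h \<otimes> b) = \<zero>"
proof -
  have g: "g \<in> carrier R" "h \<in> carrier R" using assms by (auto simp: idempotents_iff)
  have "(g \<otimes> a) \<otimes> (h \<otimes> b) = g \<otimes> (a \<otimes> h) \<otimes> b" using g assms(4,5) by (simp add: m_assoc)
  also have "a \<otimes> h = h \<otimes> a" using assms idempotent_central by simp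
  also have "g \<otimes> (h \<otimes> a) \<otimes> b = (g \<otimes> h) \<otimes> (a \<otimes> b)" using g assms(4,5) by (simp add: m_assoc)
  finally show ?thesis using assms by simp
qed

text \<open>A central idempotent \<open>g\<close> splits the ring as the product of
  \<open>gR\<close> and \<open>(1 - g)R\<close>, in which multiplication is componentwise.\<close>

lemma peirce_mult:
  assumes g: "g \<in> idempotents R"
    and c: "a \<in> carrier R" "b \<in> carrier R" "a' \<in> carrier R" "b' \<in> carrier R"
  shows "(g \<otimes> a \<oplus> (\<one> \<ominus> g) \<otimes> b) \<otimes> (g \<otimes> a' \<oplus> (\<one> \<ominus> g) \<otimes> b') = g \<otimes> (a \<otimes> a') \<oplus> (\<one> \<ominus> g) \<otimes> (b \<otimes> b')"
proof -
  note h = one_minus_idempotent[OF g]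
  have gc: "g \<in> carrier R" "\<one> \<ominus> g \<in> carrier R" using g h(1) by (auto simp: idempotents_iff)
  show ?thesis
    using gc c by (simp add: l_distr r_distr idempotent_mult_distrib[OF g]
        idempotent_mult_distrib[OF h(1)] orthogonal_mult_zero[OF g h(1,2)] orthogonal_mult_zero[OF h(1) g h(3)])
qed

lemma peirce_idempotent:
  assumes g: "g \<in> idempotents R" and e: "e \<in> idempotents R" "f \<in> idempotents R"
  shows "g \<otimes> e \<oplus> (\<one> \<ominus> g) \<otimes> f \<in> idempotents R"
  using assms peirce_mult[OF g, of e f e f] by (auto simp: idempotents_iff)

text \<open>On \<open>gR\<close> the element \<open>b\<close> is a left inverse of \<open>w\<close>,
  on \<open>(1 - g)R\<close> the inverse of \<open>u\<close> serves; direct finiteness makes the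
  glued left inverse two-sided.\<close>

lemma peirce_Units:
  assumes g: "g \<in> idempotents R" and c: "w \<in> carrier R" "b \<in> carrier R" "b \<otimes> w = g"
    and u: "u \<in> Units R"
  shows "g \<otimes> w \<oplus> (\<one> \<ominus> g) \<otimes> u \<in> Units R"
proof (rule left_inverse_imp_Units)
  have gc: "g \<in> carrier R" "g \<otimes> g = g" using g by (auto simp: idempotents_iff)
  show "g \<otimes> w \<oplus> (\<one> \<ominus> g) \<otimes> u \<in> carrier R" "g \<otimes> b \<oplus> (\<one> \<ominus> g) \<otimes> inv u \<in> carrier R"
    using gc(1) c u by auto
  have "(g \<otimes> b \<oplus> (\<one> \<ominus> g) \<otimes> inv u) \<otimes> (g \<otimes> w \<oplus> (\<one> \<ominus> g) \<otimes> u)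
      = g \<otimes> g \<oplus> (\<one> \<ominus> g) \<otimes> \<one>"
    using peirce_mult[OF g] c u by (simp add: Units_closed)
  also have "\<dots> = \<one>" unfolding gc(2) using gc(1) by algebra
  finally show "(g \<otimes> b \<oplus> (\<one> \<ominus> g) \<otimes> inv u) \<otimes> (g \<otimes> w \<oplus> (\<one> \<ominus> g) \<otimes> u) = \<one>" .
qed

text \<open>The annihilator of \<open>f\<close> is a two-sided ideal because \<open>f\<close> is
  central, and it contains \<open>1 - f\<close>. If \<open>f\<close> were nonzero, it would be
  proper, and a maximal ideal above it would contain both \<open>1 - f\<close> and
  \<open>f\<close>.\<close>

lemma idempotent_in_Jstar_eq_zero:
  assumes f: "f \<in> idempotents R" and fJ: "f \<in> Jstar R"
  shows "f = \<zero>"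
proof (rule ccontr)
  assume nz: "f \<noteq> \<zero>"
  have fc: "f \<in> carrier R" using f by (simp add: idempotents_iff)
  define I where "I = {y \<in> carrier R. f \<otimes> y = \<zero>}"
  have "ideal I R"
  proof (rule idealI[OF ring_axioms])
    show "subgroup I (add_monoid R)"
      by (rule add.subgroupI) (use fc in \<open>auto simp: I_def r_minus r_distr\<close>)
    fix a x assume ax: "a \<in> I" "x \<in> carrier R"
    show "a \<otimes> x \<in> I" using ax fc by (auto simp: I_def m_assoc[symmetric])
    have "f \<otimes> (x \<otimes> a) = x \<otimes> (f \<otimes> a)"
      using ax fc idempotent_central[OF f ax(2)] by (simp add: I_def flip: m_assoc) (simp add: m_assoc)
    then show "x \<otimes> a \<in> I" using ax by (auto simp: I_def)
  qed
  moreover have "\<one> \<notin> I" using nz fc by (simp add: I_def)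
  then have "I \<noteq> carrier R" by auto
  ultimately obtain M where M: "maximalideal M R" "I \<subseteq> M" using maximalideal_exists by blast
  interpret maximalideal M R by (rule M(1))
  have "\<one> \<ominus> f \<in> M" using M(2) one_minus_idempotent[OF f] fc by (auto simp: I_def)
  moreover have "f \<in> M" using fJ M(1) by (simp add: Jstar_def)
  ultimately have "(\<one> \<ominus> f) \<oplus> f \<in> M" by (rule a_closed)
  also have "(\<one> \<ominus> f) \<oplus> f = \<one>" using fc by algebra
  finally show False using one_imp_carrier I_notcarr by simp
qed

text \<open>The element \<open>e(1 - f) = (e - f)(1 - f)\<close> is an idempotent in
  \<open>Jstar\<close>, hence zero, so \<open>e = ef\<close>. Exchanging the roles gives
  \<open>f = fe\<close>, and \<open>e\<close> commutes with \<open>f\<close>.\<close>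

lemma idempotents_eq_mod_Jstar:
  assumes e: "e \<in> idempotents R" and f: "f \<in> idempotents R" and ef: "e \<ominus> f \<in> Jstar R"
  shows "e = f"
proof -
  have absorb: "e = e \<otimes> f"
    if e: "e \<in> idempotents R" and f: "f \<in> idempotents R" and ef: "e \<ominus> f \<in> Jstar R" for e f
  proof -
    have c: "e \<in> carrier R" "f \<in> carrier R" using e f by (auto simp: idempotents_iff)
    note f' = one_minus_idempotent[OF f]
    have "(e \<ominus> f) \<otimes> (\<one> \<ominus> f) \<in> Jstar R" using ef c by (intro Jstar_r_closed) auto
    also have "(e \<ominus> f) \<otimes> (\<one> \<ominus> f) = e \<otimes> (\<one> \<ominus> f) \<ominus> f \<otimes> (\<one> \<ominus> f)" using c by algebra
    also have "\<dots> = e \<otimes> (\<one> \<ominus> f)" using c f'(2) by (simp add: minus_eq)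
    finally have z: "e \<otimes> (\<one> \<ominus> f) = \<zero>"
      using idempotent_in_Jstar_eq_zero idempotent_mult e f'(1) by blast
    have "e = e \<otimes> (\<one> \<ominus> f) \<oplus> e \<otimes> f" using c by algebra
    then show ?thesis using z c by simp
  qed
  have c: "e \<in> carrier R" "f \<in> carrier R" using e f by (auto simp: idempotents_iff)
  have "\<ominus> (e \<ominus> f) \<in> Jstar R" using ef by (rule Jstar_uminus_closed)
  also have "\<ominus> (e \<ominus> f) = f \<ominus> e" using c by algebra
  finally have "f = f \<otimes> e" using absorb e f by blast
  then show ?thesis using absorb[OF e f ef] idempotent_central[OF e c(2)] by simp
qed

text \<open>Uniqueness is recorded for the idempotent only, since it determines the unit.\<close>

lemma uniquely_clean_obtain:
  assumes "uniquely_clean R x"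
  obtains e u where "e \<in> idempotents R" "u \<in> Units R" "x = e \<oplus> u"
    "\<And>e' u'. e' \<in> idempotents R \<Longrightarrow> u' \<in> Units R \<Longrightarrow> x = e' \<oplus> u' \<Longrightarrow> e' = e"
proof -
  obtain p where p: "fst p \<in> idempotents R" "snd p \<in> Units R" "x = fst p \<oplus> snd p"
    and un: "\<And>p'. fst p' \<in> idempotents R \<and> snd p' \<in> Units R \<and> x = fst p' \<oplus> snd p' \<Longrightarrow> p' = p"
    using assms unfolding uniquely_clean_def by blast
  have "e' = fst p" if "e' \<in> idempotents R" "u' \<in> Units R" "x = e' \<oplus> u'" for e' u'
    using un[of "(e', u')"] that by auto
  then show ?thesis using that p by blast
qed

text \<open>The exchange idempotent is \<open>1 - e\<close>. Multiplying \<open>a^n = e + u\<close>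
  by \<open>1 - e\<close> gives \<open>(1 - e)a^n = u(1 - e)\<close>, so \<open>1 - e\<close> lies
  in \<open>Ra\<close>; multiplying \<open>1 - a^n\<close> by \<open>e\<close> gives
  \<open>-ue\<close>, so \<open>e\<close> lies in \<open>R(1 - a^n)\<close>, which is inside
  \<open>R(1 - a)\<close>.\<close>

lemma clean_pow_exchange:
  assumes a: "a \<in> carrier R" "(n::nat) > 0" and e: "e \<in> idempotents R" and u: "u \<in> Units R"
    and an: "a [^] n = e \<oplus> u"
  shows "\<exists>f \<in> idempotents R. (\<exists>s \<in> carrier R. f = s \<otimes> a) \<and> (\<exists>t \<in> carrier R. \<one> \<ominus> f = t \<otimes> (\<one> \<ominus> a))"
proof (rule bexI[of _ "\<one> \<ominus> e"], rule conjI)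
  note f = one_minus_idempotent[OF e]
  show "\<one> \<ominus> e \<in> idempotents R" by (rule f(1))
  have c: "e \<in> carrier R" "e \<otimes> e = e" "u \<in> carrier R" "inv u \<in> carrier R" "a [^] n \<in> carrier R"
    using e u a by (auto simp: idempotents_iff)
  obtain k where k: "n = Suc k" using a(2) gr0_implies_Suc by blast
  have "inv u \<otimes> (\<one> \<ominus> e) \<otimes> a [^] n = inv u \<otimes> ((\<one> \<ominus> e) \<otimes> e) \<oplus> inv u \<otimes> ((\<one> \<ominus> e) \<otimes> u)"
    unfolding an using c(1,3,4) by (simp add: m_assoc r_distr)
  also have "\<dots> = inv u \<otimes> (u \<otimes> (\<one> \<ominus> e))"
    using c f(3) idempotent_central[OF f(1) c(3)] by simp
  also have "\<dots> = \<one> \<ominus> e" using c u by (simp add: m_assoc[symmetric])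
  finally have "\<one> \<ominus> e = (inv u \<otimes> (\<one> \<ominus> e) \<otimes> a [^] k) \<otimes> a"
    using k c a by (simp add: m_assoc)
  then show "\<exists>s \<in> carrier R. \<one> \<ominus> e = s \<otimes> a" using c a by blast
  obtain s where s: "s \<in> carrier R" "\<one> \<ominus> a [^] n = s \<otimes> (\<one> \<ominus> a)"
    using one_minus_pow[OF a(1)] by blast
  have "e \<otimes> (\<one> \<ominus> a [^] n) = e \<ominus> e \<otimes> e \<ominus> e \<otimes> u" unfolding an using c(1,3) by algebra
  also have "\<dots> = \<ominus> (u \<otimes> e)" using c idempotent_central[OF e c(3)] by (simp add: minus_eq r_neg)
  finally have eq: "e \<otimes> (\<one> \<ominus> a [^] n) = \<ominus> (u \<otimes> e)" .
  have "e = (inv u \<otimes> u) \<otimes> e" using c u by simp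
  also have "\<dots> = \<ominus> (inv u) \<otimes> (\<ominus> (u \<otimes> e))" using c(1,3,4) by algebra
  also have "\<dots> = \<ominus> (inv u) \<otimes> (e \<otimes> (s \<otimes> (\<one> \<ominus> a)))" using eq s(2) by simp
  also have "\<dots> = (\<ominus> (inv u) \<otimes> e \<otimes> s) \<otimes> (\<one> \<ominus> a)" using c(1,3,4) s(1) a(1) by (simp add: m_assoc)
  finally have "\<one> \<ominus> (\<one> \<ominus> e) = (\<ominus> (inv u) \<otimes> e \<otimes> s) \<otimes> (\<one> \<ominus> a)" using f(4) by simp
  then show "\<exists>t \<in> carrier R. \<one> \<ominus> (\<one> \<ominus> e) = t \<otimes> (\<one> \<ominus> a)" using c s(1) by blast
qed

lemma no_idempotent_multiple:
  assumes e: "e \<in> idempotents R" and u: "u \<in> Units R" and x: "x = e \<oplus> u"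
    and un: "\<And>e' u'. e' \<in> idempotents R \<Longrightarrow> u' \<in> Units R \<Longrightarrow> x = e' \<oplus> u' \<Longrightarrow> e' = e"
    and g: "g \<in> idempotents R" and b: "b \<in> carrier R" "g = b \<otimes> (x \<ominus> (\<one> \<ominus> e))"
  shows "g = \<zero>"
proof -
  note f = one_minus_idempotent[OF e] and h = one_minus_idempotent[OF g]
  define w where "w = x \<ominus> (\<one> \<ominus> e)"
  have c: "e \<in> carrier R" "u \<in> carrier R" "x \<in> carrier R" "w \<in> carrier R" "g \<in> carrier R"
      "e \<otimes> e = e" "g \<otimes> g = g"
    using e u g by (auto simp: idempotents_iff x w_def)
  have U: "g \<otimes> w \<oplus> (\<one> \<ominus> g) \<otimes> u \<in> Units R" using peirce_Units[OF g c(4) b(1) _ u] b by (simp add: w_def)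
  \<comment> \<open>On \<open>gR\<close> the element \<open>x\<close> splits as
    \<open>(1 - e) + w\<close>, on \<open>(1 - g)R\<close> as \<open>e + u\<close>. Glued together
    these form a clean decomposition, whose idempotent must be \<open>e\<close>.\<close>
  have "x = (g \<otimes> (\<one> \<ominus> e) \<oplus> (\<one> \<ominus> g) \<otimes> e) \<oplus> (g \<otimes> w \<oplus> (\<one> \<ominus> g) \<otimes> u)"
    unfolding w_def x using c(1,2,5) by algebra
  then have eq: "g \<otimes> (\<one> \<ominus> e) \<oplus> (\<one> \<ominus> g) \<otimes> e = e"
    using un[OF peirce_idempotent[OF g f(1) e] U] by simp
  have "e = g \<otimes> e \<oplus> (\<one> \<ominus> g) \<otimes> e" using c(1,5) by algebra
  then have "g \<otimes> (\<one> \<ominus> e) \<oplus> (\<one> \<ominus> g) \<otimes> e = g \<otimes> e \<oplus> (\<one> \<ominus> g) \<otimes> e" using eq by simp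
  then have ge: "g \<otimes> (\<one> \<ominus> e) = g \<otimes> e" using c(1,5) by simp
  \<comment> \<open>Multiplying \<open>g(1 - e) = ge\<close> by \<open>e\<close> kills the left
    side, so \<open>ge\<close> and hence also \<open>g(1 - e)\<close> vanish.\<close>
  have "g \<otimes> e = g \<otimes> e \<otimes> e" using c by (simp add: m_assoc)
  also have "\<dots> = g \<otimes> (\<one> \<ominus> e) \<otimes> e" by (simp add: ge)
  also have "\<dots> = \<zero>" using c f(3) by (simp add: m_assoc)
  finally have z: "g \<otimes> e = \<zero>" .
  have "g = g \<otimes> (\<one> \<ominus> e) \<oplus> g \<otimes> e" using c(1,5) by algebra
  then show ?thesis using ge z by simp
qed

end

section \<open>Exchange rings with central idempotents\<close>

locale abelian_exchange_ring = abelian_ring +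
  assumes exchange: "a \<in> carrier R \<Longrightarrow>
    \<exists>f \<in> idempotents R. (\<exists>s \<in> carrier R. f = s \<otimes> a) \<and> (\<exists>t \<in> carrier R. \<one> \<ominus> f = t \<otimes> (\<one> \<ominus> a))"
begin

text \<open>Exchange for \<open>yw\<close> yields an idempotent in \<open>Rw\<close>, which is zero
  by hypothesis, so its complement \<open>1\<close> lies in \<open>R(1 - yw)\<close>. Thus every
  \<open>1 - yw\<close> is a unit and \<open>w\<close> lies in the Jacobson radical.\<close>

lemma mem_JstarI:
  assumes w: "w \<in> carrier R"
    and z: "\<And>g b. g \<in> idempotents R \<Longrightarrow> b \<in> carrier R \<Longrightarrow> g = b \<otimes> w \<Longrightarrow> g = \<zero>"
  shows "w \<in> Jstar R"
proof -
  have "\<one> \<ominus> y \<otimes> w \<in> Units R" if y: "y \<in> carrier R" for y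
  proof -
    obtain f s t where f: "f \<in> idempotents R" "s \<in> carrier R" "f = s \<otimes> (y \<otimes> w)"
      "t \<in> carrier R" "\<one> \<ominus> f = t \<otimes> (\<one> \<ominus> y \<otimes> w)"
      using exchange[of "y \<otimes> w"] y w by blast
    have "f = \<zero>" using z[of f "s \<otimes> y"] f y w by (simp add: m_assoc)
    then have "t \<otimes> (\<one> \<ominus> y \<otimes> w) = \<one>" using f(5) by (simp add: minus_eq)
    then show ?thesis using left_inverse_imp_Units f(4) y w by simp
  qed
  then show ?thesis using w jacobson_radical_subset_Jstar by (auto simp: jacobson_radical_def)
qed

text \<open>Here the exchange idempotent lies in \<open>Rx\<close>, hence in \<open>Jstar\<close>,
  and vanishes. So in these rings \<open>Jstar\<close> is no larger than the Jacobson
  radical.\<close>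

lemma one_minus_Jstar_Units:
  assumes x: "x \<in> Jstar R"
  shows "\<one> \<ominus> x \<in> Units R"
proof -
  have xc: "x \<in> carrier R" using x by (rule Jstar_closed)
  obtain f s t where f: "f \<in> idempotents R" "s \<in> carrier R" "f = s \<otimes> x"
    "t \<in> carrier R" "\<one> \<ominus> f = t \<otimes> (\<one> \<ominus> x)"
    using exchange[OF xc] by blast
  have "f = \<zero>" using idempotent_in_Jstar_eq_zero f x Jstar_l_closed by blast
  then have "t \<otimes> (\<one> \<ominus> x) = \<one>" using f(5) by (simp add: minus_eq)
  then show ?thesis using left_inverse_imp_Units f(4) xc by simp
qed

end

section \<open>Uniquely pi-clean rings satisfy conditions (1) and (2)\<close>

context ring begin

lemma Units_uminus:
  assumes "u \<in> Units R"
  shows "\<ominus> u \<in> Units R"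
  using assms by (intro UnitsI[of _ "\<ominus> (inv u)"]) (simp_all add: l_minus r_minus Units_closed)

text \<open>From \<open>g = cx^n\<close> and \<open>g = gbx = bgx\<close> follows
  \<open>g = (bc)x^(n+1)\<close>. This permits passing from \<open>x\<close> to a uniquely clean
  power of it.\<close>

lemma idempotent_multiple_pow:
  assumes "g \<in> idempotents R" "x \<in> carrier R" "b \<in> carrier R" "g = b \<otimes> x"
    and central: "\<And>y. y \<in> carrier R \<Longrightarrow> g \<otimes> y = y \<otimes> g"
  shows "\<exists>c \<in> carrier R. g = c \<otimes> x [^] (n::nat)"
proof (induction n)
  case 0
  have "g \<in> carrier R" using assms(1) by (simp add: idempotents_iff)
  then show ?case by (auto intro: bexI[of _ g])
next
  case (Suc n)
  then obtain c where c: "c \<in> carrier R" "g = c \<otimes> x [^] n" by blast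
  have g: "g \<in> carrier R" "g \<otimes> g = g" using assms(1) by (auto simp: idempotents_iff)
  have "g = g \<otimes> (b \<otimes> x)" using g(2) by (simp flip: assms(4))
  also have "\<dots> = b \<otimes> g \<otimes> x" using g(1) assms(2,3) central[OF assms(3)] by (simp flip: m_assoc)
  also have "\<dots> = (b \<otimes> c) \<otimes> x [^] Suc n"
    unfolding nat_pow_Suc c(2) using c(1) assms(2,3) by (simp add: m_assoc)
  finally show ?case using c(1) assms(3) by blast
qed

lemma uniquely_pi_clean_imp_abelian_exchange:
  assumes "uniquely_pi_clean_ring R"
  shows "abelian_exchange_ring R"
proof -
  \<comment> \<open>Every positive power of an idempotent is that idempotent, so a uniquely clean
    power is \<open>e\<close> itself.\<close>
  have "uniquely_clean R e" if "e \<in> idempotents R" for e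
    using assms that idempotent_pow[OF that] unfolding uniquely_pi_clean_ring_def
    by (metis idempotents_iff)
  then interpret abelian_ring R
    by unfold_locales (rule uniquely_clean_idempotents_central)
  show ?thesis
  proof
    fix a assume a: "a \<in> carrier R"
    then obtain n :: nat where n: "n > 0" "uniquely_clean R (a [^] n)"
      using assms unfolding uniquely_pi_clean_ring_def by blast
    obtain e u where "e \<in> idempotents R" "u \<in> Units R" "a [^] n = e \<oplus> u"
      by (rule uniquely_clean_obtain[OF n(2)])
    then show "\<exists>f \<in> idempotents R. (\<exists>s \<in> carrier R. f = s \<otimes> a) \<and> (\<exists>t \<in> carrier R. \<one> \<ominus> f = t \<otimes> (\<one> \<ominus> a))"
      by (rule clean_pow_exchange[OF a n(1)])
  qed
qed

lemma uniquely_pi_clean_imp_Jstar_eq: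
  assumes upc: "uniquely_pi_clean_ring R"
  shows "Jstar R = {x \<in> carrier R. \<forall>m::nat. m > 0 \<longrightarrow> x [^] m \<ominus> \<one> \<in> Units R}"
proof (intro subset_antisym subsetI)
  interpret abelian_exchange_ring R using upc by (rule uniquely_pi_clean_imp_abelian_exchange)
  fix x assume x: "x \<in> Jstar R"
  then have xc: "x \<in> carrier R" by (rule Jstar_closed)
  have "x [^] m \<ominus> \<one> \<in> Units R" if m: "m > 0" for m :: nat
  proof -
    obtain k where "m = Suc k" using m by (cases m) auto
    then have "x [^] m \<in> Jstar R" using x xc by (simp add: Jstar_l_closed)
    then have "\<ominus> (\<one> \<ominus> x [^] m) \<in> Units R" by (intro Units_uminus one_minus_Jstar_Units)
    also have "\<ominus> (\<one> \<ominus> x [^] m) = x [^] m \<ominus> \<one>" using nat_pow_closed[OF xc, of m] by algebra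
    finally show ?thesis .
  qed
  then show "x \<in> {x \<in> carrier R. \<forall>m::nat. m > 0 \<longrightarrow> x [^] m \<ominus> \<one> \<in> Units R}" using xc by blast
next
  interpret abelian_exchange_ring R using upc by (rule uniquely_pi_clean_imp_abelian_exchange)
  fix x assume "x \<in> {x \<in> carrier R. \<forall>m::nat. m > 0 \<longrightarrow> x [^] m \<ominus> \<one> \<in> Units R}"
  then have xc: "x \<in> carrier R" and xU: "\<And>m::nat. m > 0 \<Longrightarrow> x [^] m \<ominus> \<one> \<in> Units R" by auto
  obtain n :: nat where n: "n > 0" "uniquely_clean R (x [^] n)"
    using upc xc unfolding uniquely_pi_clean_ring_def by blast
  have pc: "x [^] n \<in> carrier R" using xc by simp
  have one: "\<one> \<in> idempotents R" by (simp add: idempotents_iff)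
  have sum: "x [^] n = \<one> \<oplus> (x [^] n \<ominus> \<one>)" using pc by algebra
  obtain e where un: "\<And>e' u'. e' \<in> idempotents R \<Longrightarrow> u' \<in> Units R \<Longrightarrow> x [^] n = e' \<oplus> u' \<Longrightarrow> e' = e"
    by (rule uniquely_clean_obtain[OF n(2)]) blast
  \<comment> \<open>Since \<open>1 + (x^n - 1)\<close> is a clean decomposition of
    \<open>x^n\<close>, the unique idempotent is \<open>1\<close>.\<close>
  then have "e = \<one>" using one xU[OF n(1)] sum by blast
  note un = un[unfolded this]
  \<comment> \<open>With idempotent part \<open>1\<close>, the element tested in
    \<open>no_idempotent_multiple\<close> is \<open>x^n\<close> itself.\<close>
  have w: "x [^] n \<ominus> (\<one> \<ominus> \<one>) = x [^] n" using pc by algebra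
  show "x \<in> Jstar R"
  proof (rule mem_JstarI[OF xc])
    fix g b assume g: "g \<in> idempotents R" "b \<in> carrier R" "g = b \<otimes> x"
    then obtain c where "c \<in> carrier R" "g = c \<otimes> x [^] n"
      using idempotent_multiple_pow[OF g(1) xc g(2,3)] idempotent_central[OF g(1)] by blast
    then show "g = \<zero>"
      using no_idempotent_multiple[OF one xU[OF n(1)] sum un g(1)] w by simp
  qed
qed

lemma uniquely_pi_clean_imp_idempotent_mod_Jstar:
  assumes upc: "uniquely_pi_clean_ring R" and a: "a \<in> carrier R"
  shows "\<exists>m::nat. m > 0 \<and> (\<exists>!e. e \<in> idempotents R \<and> a [^] m \<ominus> e \<in> Jstar R)"
proof -
  interpret abelian_exchange_ring R using upc by (rule uniquely_pi_clean_imp_abelian_exchange)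
  obtain n :: nat where n: "n > 0" "uniquely_clean R (a [^] n)"
    using upc a unfolding uniquely_pi_clean_ring_def by blast
  have pc: "a [^] n \<in> carrier R" using a by simp
  obtain e u where eu: "e \<in> idempotents R" "u \<in> Units R" "a [^] n = e \<oplus> u"
    "\<And>e' u'. e' \<in> idempotents R \<Longrightarrow> u' \<in> Units R \<Longrightarrow> a [^] n = e' \<oplus> u' \<Longrightarrow> e' = e"
    by (rule uniquely_clean_obtain[OF n(2)]) blast
  have fi: "\<one> \<ominus> e \<in> idempotents R" using one_minus_idempotent[OF eu(1)] by blast
  \<comment> \<open>The idempotent congruent to \<open>a^n\<close> is the complement of the clean
    one.\<close>
  have wJ: "a [^] n \<ominus> (\<one> \<ominus> e) \<in> Jstar R"
  proof (rule mem_JstarI)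
    show "a [^] n \<ominus> (\<one> \<ominus> e) \<in> carrier R" using pc fi by (simp add: idempotents_iff)
  qed (rule no_idempotent_multiple[OF eu])
  \<comment> \<open>Any competing \<open>f\<close> is congruent to \<open>1 - e\<close> modulo
    \<open>Jstar\<close>, and congruent idempotents coincide.\<close>
  have "f = \<one> \<ominus> e" if f: "f \<in> idempotents R" "a [^] n \<ominus> f \<in> Jstar R" for f
  proof (rule idempotents_eq_mod_Jstar[OF f(1) fi])
    have "(a [^] n \<ominus> (\<one> \<ominus> e)) \<ominus> (a [^] n \<ominus> f) \<in> Jstar R" using wJ f(2) by (rule Jstar_minus_closed)
    also have "(a [^] n \<ominus> (\<one> \<ominus> e)) \<ominus> (a [^] n \<ominus> f) = f \<ominus> (\<one> \<ominus> e)"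
    proof -
      have "e \<in> carrier R" "f \<in> carrier R" using eu f by (auto simp: idempotents_iff)
      then show ?thesis using pc by algebra
    qed
    finally show "f \<ominus> (\<one> \<ominus> e) \<in> Jstar R" .
  qed
  then show ?thesis using n(1) fi wJ by blast
qed

section \<open>Conditions (1) and (2) imply uniquely pi-clean\<close>

lemma idempotent_mod_Jstar_imp_abelian:
  assumes idem: "\<And>a. a \<in> carrier R \<Longrightarrow>
      \<exists>m::nat. m > 0 \<and> (\<exists>!e. e \<in> idempotents R \<and> a [^] m \<ominus> e \<in> Jstar R)"
    and J: "Jstar R = {x \<in> carrier R. \<forall>m::nat. m > 0 \<longrightarrow> x [^] m \<ominus> \<one> \<in> Units R}"
  shows "abelian_ring R"
proof
  fix e r assume e: "e \<in> idempotents R" and r: "r \<in> carrier R"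
  show "e \<otimes> r = r \<otimes> e"
  proof (rule idempotents_central_if[OF _ e r])
    fix e r assume e: "e \<in> idempotents R" and r: "r \<in> carrier R"
    define z where "z = e \<otimes> r \<otimes> (\<one> \<ominus> e)"
    note z = peirce_corner[OF e r, folded z_def]
    have ec: "e \<in> carrier R" using e by (simp add: idempotents_iff)
    have "z \<in> Jstar R" unfolding J using z square_zero_imp_unit by blast
    then have zJ: "\<ominus> z \<in> Jstar R" "z \<ominus> z \<in> Jstar R"
      by (simp_all add: Jstar_uminus_closed Jstar_minus_closed)
    \<comment> \<open>Writing \<open>0\<close> as \<open>z - z\<close> shows that it lies in
      \<open>Jstar\<close>. Thus \<open>e\<close> and \<open>e + z\<close> are both congruent to
      \<open>e^m = e\<close>, and uniqueness in (1) makes them equal.\<close>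
    have "e \<ominus> e = z \<ominus> z" "e \<ominus> (e \<oplus> z) = \<ominus> z" using ec z(1) by algebra+
    then have "e \<ominus> e \<in> Jstar R" "e \<ominus> (e \<oplus> z) \<in> Jstar R" using zJ by simp_all
    moreover obtain m :: nat where "m > 0" "\<exists>!f. f \<in> idempotents R \<and> e [^] m \<ominus> f \<in> Jstar R"
      using idem[OF ec] by blast
    moreover from this have "e [^] m = e" using idempotent_pow[OF e] by blast
    ultimately have "e = e \<oplus> z" using e z(5) by auto
    then show "e \<otimes> r \<otimes> (\<one> \<ominus> e) = \<zero>" using ec z(1) by (simp add: z_def[symmetric])
  qed
qed

lemma idempotent_mod_Jstar_imp_uniquely_clean:
  assumes "abelian_ring R" and J: "\<And>x. x \<in> Jstar R \<Longrightarrow> x \<ominus> \<one> \<in> Units R"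
    and e: "e \<in> idempotents R" and a: "a \<in> carrier R" and aJ: "a \<ominus> e \<in> Jstar R"
  shows "uniquely_clean R a"
proof -
  interpret abelian_ring R by fact
  note h = one_minus_idempotent[OF e]
  have ec: "e \<in> carrier R" using e by (simp add: idempotents_iff)
  define q where "q = e \<ominus> (\<one> \<ominus> e)"
  have qc: "q \<in> carrier R" using ec by (simp add: q_def)
  have qq: "q \<otimes> q = \<one>" unfolding q_def by (rule idempotent_reflection[OF e])
  \<comment> \<open>Chosen so that \<open>q(1 - w) = q + (a - e)\<close>, because
    \<open>q^2 = 1\<close>. The intended unit part \<open>2e - 1 + (a - e)\<close> is thereby a
    product of two units.\<close>
  define w where "w = \<ominus> q \<otimes> (a \<ominus> e)"
  have w: "w \<in> Jstar R" using qc aJ by (simp add: w_def Jstar_l_closed)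
  have qU: "q \<in> Units R" "\<ominus> (w \<ominus> \<one>) \<in> Units R"
    using qc qq UnitsI J[OF w] Units_uminus by blast+
  then have U: "q \<otimes> (\<ominus> (w \<ominus> \<one>)) \<in> Units R" by blast
  have "(\<one> \<ominus> e) \<oplus> q \<otimes> (\<ominus> (w \<ominus> \<one>)) = (\<one> \<ominus> e) \<oplus> q \<oplus> (q \<otimes> q) \<otimes> (a \<ominus> e)"
    unfolding w_def using qc ec a by algebra
  also have "\<dots> = a" unfolding qq unfolding q_def using ec a by algebra
  finally have sum: "a = (\<one> \<ominus> e) \<oplus> q \<otimes> (\<ominus> (w \<ominus> \<one>))" by simp
  have un: "f = \<one> \<ominus> e" if f: "f \<in> idempotents R" and v: "v \<in> Units R" and av: "a = f \<oplus> v" for f v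
  proof -
    note f' = one_minus_idempotent[OF f]
    have c: "f \<in> carrier R" "v \<in> carrier R" "inv v \<in> carrier R" "v \<otimes> inv v = \<one>" "f \<otimes> f = f" "e \<otimes> e = e"
      using f e v by (auto simp: idempotents_iff)
    have fJ: "f \<oplus> v \<ominus> e \<in> Jstar R" using aJ av by simp
    \<comment> \<open>If \<open>kf = ke\<close>, then \<open>k(f + v - e)v^-1\<close> is
      \<open>k\<close> itself, which makes \<open>k\<close> an idempotent in \<open>Jstar\<close>.
      The cases needed are \<open>ef\<close> and \<open>(1 - e)(1 - f)\<close>.\<close>
    have zero: "k = \<zero>" if k: "k \<in> idempotents R" and kf: "k \<otimes> f = k \<otimes> e" for k
    proof -
      have kc: "k \<in> carrier R" using k by (simp add: idempotents_iff)
      have "k \<otimes> (f \<oplus> v \<ominus> e) \<otimes> inv v \<in> Jstar R"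
        using fJ kc c by (intro Jstar_r_closed Jstar_l_closed)
      also have "k \<otimes> (f \<oplus> v \<ominus> e) \<otimes> inv v = (k \<otimes> f \<ominus> k \<otimes> e) \<otimes> inv v \<oplus> k \<otimes> (v \<otimes> inv v)"
        using kc c(1-3) ec by algebra
      also have "\<dots> = k" using kf kc c ec by (simp add: minus_eq r_neg)
      finally show ?thesis using idempotent_in_Jstar_eq_zero k by blast
    qed
    have comm: "f \<otimes> e = e \<otimes> f" "(\<one> \<ominus> f) \<otimes> e = e \<otimes> (\<one> \<ominus> f)"
      using idempotent_central f f'(1) ec by blast+
    have "e \<otimes> f = \<zero>"
    proof (rule zero[OF idempotent_mult[OF e f]])
      have "e \<otimes> f \<otimes> e = e \<otimes> (e \<otimes> f)" using c ec comm by (simp add: m_assoc)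
      also have "\<dots> = (e \<otimes> e) \<otimes> f" using c(1) ec by (simp add: m_assoc)
      finally show "e \<otimes> f \<otimes> f = e \<otimes> f \<otimes> e" using c ec by (simp add: m_assoc)
    qed
    moreover have "(\<one> \<ominus> e) \<otimes> (\<one> \<ominus> f) = \<zero>"
    proof (rule zero[OF idempotent_mult[OF h(1) f'(1)]])
      have "(\<one> \<ominus> e) \<otimes> (\<one> \<ominus> f) \<otimes> e = (\<one> \<ominus> e) \<otimes> (e \<otimes> (\<one> \<ominus> f))" using c ec comm by (simp add: m_assoc)
      also have "\<dots> = ((\<one> \<ominus> e) \<otimes> e) \<otimes> (\<one> \<ominus> f)" using c(1) ec by (simp add: m_assoc)
      also have "\<dots> = \<zero>" using h(3) c by simp
      finally show "(\<one> \<ominus> e) \<otimes> (\<one> \<ominus> f) \<otimes> f = (\<one> \<ominus> e) \<otimes> (\<one> \<ominus> f) \<otimes> e"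
        using c ec f'(3) by (simp add: m_assoc)
    qed
    \<comment> \<open>Both products on the right vanish, leaving \<open>f = 1 - e\<close>.\<close>
    moreover have "f = (\<one> \<ominus> e) \<ominus> (\<one> \<ominus> e) \<otimes> (\<one> \<ominus> f) \<oplus> e \<otimes> f" using ec c(1) by algebra
    ultimately show ?thesis using ec by (simp add: minus_eq)
  qed
  show ?thesis unfolding uniquely_clean_def
  proof (rule ex1I[of _ "(\<one> \<ominus> e, q \<otimes> (\<ominus> (w \<ominus> \<one>)))"])
    show "fst (\<one> \<ominus> e, q \<otimes> (\<ominus> (w \<ominus> \<one>))) \<in> idempotents R \<and> snd (\<one> \<ominus> e, q \<otimes> (\<ominus> (w \<ominus> \<one>))) \<in> Units R
       \<and> a = fst (\<one> \<ominus> e, q \<otimes> (\<ominus> (w \<ominus> \<one>))) \<oplus> snd (\<one> \<ominus> e, q \<otimes> (\<ominus> (w \<ominus> \<one>)))"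
      using h(1) U sum by simp
    fix p assume p: "fst p \<in> idempotents R \<and> snd p \<in> Units R \<and> a = fst p \<oplus> snd p"
    then have 1: "fst p = \<one> \<ominus> e" using un by blast
    then have "(\<one> \<ominus> e) \<oplus> snd p = (\<one> \<ominus> e) \<oplus> q \<otimes> (\<ominus> (w \<ominus> \<one>))" using p sum by metis
    then have "snd p = q \<otimes> (\<ominus> (w \<ominus> \<one>))"
      using add.l_cancel[of "\<one> \<ominus> e" "snd p"] p U ec by (simp add: Units_closed)
    then show "p = (\<one> \<ominus> e, q \<otimes> (\<ominus> (w \<ominus> \<one>)))" using 1 by (simp add: prod_eq_iff)
  qed
qed

end

theorem theorem3p9:
  fixes R :: "('a, 'b) ring_scheme"
  assumes "ring R"
  shows "uniquely_pi_clean_ring R \<longleftrightarrow>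
    (\<forall>a \<in> carrier R. \<exists>m::nat. m > 0 \<and>
       (\<exists>!e. e \<in> idempotents R \<and> a [^]\<^bsub>R\<^esub> m \<ominus>\<^bsub>R\<^esub> e \<in> Jstar R)) \<and>
    Jstar R = {x \<in> carrier R. \<forall>m::nat. m > 0 \<longrightarrow> x [^]\<^bsub>R\<^esub> m \<ominus>\<^bsub>R\<^esub> \<one>\<^bsub>R\<^esub> \<in> Units R}"
    (is "_ \<longleftrightarrow> ?idem \<and> ?J")
proof -
  interpret ring R by fact
  show ?thesis
  proof (intro iffI conjI)
    assume upc: "uniquely_pi_clean_ring R"
    show ?idem using uniquely_pi_clean_imp_idempotent_mod_Jstar[OF upc] by blast
    show ?J by (rule uniquely_pi_clean_imp_Jstar_eq[OF upc])
  next
    assume "?idem \<and> ?J"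
    then have idem: ?idem and J: ?J by blast+
    have ab: "abelian_ring R" using idem by (intro idempotent_mod_Jstar_imp_abelian J) blast
    \<comment> \<open>Only the exponent \<open>1\<close> of condition (2) enters here.\<close>
    have U: "x \<ominus>\<^bsub>R\<^esub> \<one>\<^bsub>R\<^esub> \<in> Units R" if x: "x \<in> Jstar R" for x
    proof -
      have "x \<in> carrier R" "x [^]\<^bsub>R\<^esub> (1::nat) \<ominus>\<^bsub>R\<^esub> \<one>\<^bsub>R\<^esub> \<in> Units R"
        using x unfolding J by (blast intro: zero_less_one)+
      then show ?thesis by simp
    qed
    show "uniquely_pi_clean_ring R"
      unfolding uniquely_pi_clean_ring_def
    proof
      fix a assume a: "a \<in> carrier R"
      then obtain m :: nat and e where "m > 0" "e \<in> idempotents R" "a [^]\<^bsub>R\<^esub> m \<ominus>\<^bsub>R\<^esub> e \<in> Jstar R"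
        using idem by blast
      then show "\<exists>m::nat. m > 0 \<and> uniquely_clean R (a [^]\<^bsub>R\<^esub> m)"
        using idempotent_mod_Jstar_imp_uniquely_clean[OF ab U] nat_pow_closed[OF a] by blast
    qed
  qed
qed

end
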